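(* Let $(X,\mu)$ and $(Y,\mu')$ be two generalized topological spaces and let $f:X\to Y$ be a generalized homeomorphism. If $(X,\mu)$ is $g$-quasi metrizable, then so is $(Y,\mu')$.
   Context: A generalized topology $\mu$ on a nonempty set $X$ is a collection of subsets of $X$ such that $\emptyset\in\mu$ and $\mu$ is closed under arbitrary unions; $(X,\mu)$ is then called a generalized topological space. A mapping $f:X\to Y$ between generalized topological spaces $(X,\mu)$, $(Y,\mu')$ is generalized continuous if $f^{-1}(G)\in\mu$ for all $G\in\mu'$. It is a generalized homeomorphism if $f$ is bijective and both $f$ and $f^{-1}$ are generalized continuous. A $g$-quasi metric on a nonempty set $X$ is a mapping $d:X\times X\to\mathbb R$ for which there exists $r\ge 0$ (called the index of $d$) such that (a) for all $x,y\in X$, $d(x,y)\ge r$, and $d(x,y)=r\iff x=y$; (b) for all $x,y,z\in X$, $d(x,y)\le d(x,z)+d(z,y)$. (Symmetry is not assumed.) For $x\in X$ and $p>0$ let $B_d(x,p)=\{y\in X: d(x,y)<p\}$. The generalized topology $\mu(d)$ induced by $d$ is the collection of all unions of members of $\{B_d(x,p):x\in X,\ p>0\}\cup\{\emptyset\}$. A generalized topological space $(X,\mu)$ is called $g$-quasi metrizable if $\mu(d)=\mu$ for some $g$-quasi metric $d$ on $X$ (of some index $r\ge 0$). *)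

theory Defs
  imports Complex_Main "HOL-Library.FuncSet"
begin

definition generalized_topology :: "'a set \<Rightarrow> 'a set set \<Rightarrow> bool" where
  "generalized_topology X \<mu> \<longleftrightarrow>
     X \<noteq> {} \<and> \<mu> \<subseteq> Pow X \<and> {} \<in> \<mu> \<and> (\<forall>\<U>. \<U> \<subseteq> \<mu> \<longrightarrow> \<Union>\<U> \<in> \<mu>)"

definition generalized_continuous ::
  "'a set \<Rightarrow> 'a set set \<Rightarrow> 'b set \<Rightarrow> 'b set set \<Rightarrow> ('a \<Rightarrow> 'b) \<Rightarrow> bool" where
  "generalized_continuous X \<mu> Y \<mu>' f \<longleftrightarrow> f \<in> X \<rightarrow> Y \<and> (\<forall>G\<in>\<mu>'. f -` G \<inter> X \<in> \<mu>)"

definition generalized_homeomorphism ::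
  "'a set \<Rightarrow> 'a set set \<Rightarrow> 'b set \<Rightarrow> 'b set set \<Rightarrow> ('a \<Rightarrow> 'b) \<Rightarrow> bool" where
  "generalized_homeomorphism X \<mu> Y \<mu>' f \<longleftrightarrow>
     bij_betw f X Y \<and>
     generalized_continuous X \<mu> Y \<mu>' f \<and>
     generalized_continuous Y \<mu>' X \<mu> (inv_into X f)"

text \<open>Distance functions are total on the type; only their values on \<open>X\<close> are constrained
  and used. Symmetry is not required, and points have self-distance equal to the index.\<close>

definition g_quasi_metric_index :: "'a set \<Rightarrow> ('a \<Rightarrow> 'a \<Rightarrow> real) \<Rightarrow> real \<Rightarrow> bool" where
  "g_quasi_metric_index X d r \<longleftrightarrow>
     X \<noteq> {} \<and> r \<ge> 0 \<and>
     (\<forall>x\<in>X. \<forall>y\<in>X. d x y \<ge> r \<and> (d x y = r \<longleftrightarrow> x = y)) \<and>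
     (\<forall>x\<in>X. \<forall>y\<in>X. \<forall>z\<in>X. d x y \<le> d x z + d z y)"

definition g_quasi_metric :: "'a set \<Rightarrow> ('a \<Rightarrow> 'a \<Rightarrow> real) \<Rightarrow> bool" where
  "g_quasi_metric X d \<longleftrightarrow> (\<exists>r. g_quasi_metric_index X d r)"

text \<open>A ball is empty when its radius is at most the index.\<close>

definition g_quasi_ball :: "'a set \<Rightarrow> ('a \<Rightarrow> 'a \<Rightarrow> real) \<Rightarrow> 'a \<Rightarrow> real \<Rightarrow> 'a set" where
  "g_quasi_ball X d x p = {y \<in> X. d x y < p}"

definition induced_generalized_topology ::
  "'a set \<Rightarrow> ('a \<Rightarrow> 'a \<Rightarrow> real) \<Rightarrow> 'a set set" where
  "induced_generalized_topology X d =
     {\<Union>\<U> | \<U>. \<U> \<subseteq> {g_quasi_ball X d x p | x p. x \<in> X \<and> p > 0} \<union> {{}}}"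

definition g_quasi_metrizable :: "'a set \<Rightarrow> 'a set set \<Rightarrow> bool" where
  "g_quasi_metrizable X \<mu> \<longleftrightarrow>
     (\<exists>d. g_quasi_metric X d \<and> induced_generalized_topology X d = \<mu>)"

end

theory Submission
  imports Defs
begin

text \<open>The idea is transport of structure. Pulling the distance of \<open>X\<close> back along
  the inverse of \<open>f\<close> gives a distance on \<open>Y\<close> with the same index that makes the bijection \<open>f\<close>
  distance-preserving. Such a map carries balls onto balls, and since direct images
  commute with unions it carries the induced generalized topology of \<open>X\<close> onto that of \<open>Y\<close>
  (lemma \<open>induced_generalized_topology_transport\<close>). A generalized homeomorphism likewise carries
  \<open>\<mu>\<close> onto \<open>\<mu>'\<close> (lemma \<open>generalized_homeomorphism_image\<close>). If the distance on \<open>X\<close> induces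
  \<open>\<mu>\<close>, the transported one therefore induces \<open>\<mu>'\<close>.\<close>

lemma g_quasi_metric_index_transport:
  assumes "bij_betw g Y X" and "g_quasi_metric_index X d r"
  shows "g_quasi_metric_index Y (\<lambda>y z. d (g y) (g z)) r"
proof -
  have g_in: "g y \<in> X" if "y \<in> Y" for y
    using assms(1) that by (rule bij_betw_apply)
  have g_eq: "g y = g z \<longleftrightarrow> y = z" if "y \<in> Y" "z \<in> Y" for y z
    using assms(1) that by (auto simp: bij_betw_def inj_on_def)
  have "Y \<noteq> {}"
    using assms by (auto simp: g_quasi_metric_index_def bij_betw_def)
  then show ?thesis
    using assms(2) g_in g_eq by (simp add: g_quasi_metric_index_def)
qed

lemma g_quasi_ball_transport:
  assumes "bij_betw f X Y" and "x \<in> X"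
  shows "g_quasi_ball Y (\<lambda>y z. d (inv_into X f y) (inv_into X f z)) (f x) p
    = f ` g_quasi_ball X d x p"
  using assms by (force simp: g_quasi_ball_def bij_betw_def)

lemma induced_generalized_topology_transport:
  assumes "bij_betw f X Y"
  shows "induced_generalized_topology Y (\<lambda>y z. d (inv_into X f y) (inv_into X f z))
    = (`) f ` induced_generalized_topology X d" (is "induced_generalized_topology Y ?e = _")
proof -
  let ?B = "{g_quasi_ball X d x p | x p. x \<in> X \<and> p > 0} \<union> {{}}"
  let ?C = "{g_quasi_ball Y ?e y p | y p. y \<in> Y \<and> p > 0} \<union> {{}}"
  have Y: "Y = f ` X"
    using assms by (simp add: bij_betw_def)
  have "{g_quasi_ball Y ?e y p | y p. y \<in> Y \<and> p > 0}
      = {g_quasi_ball Y ?e (f x) p | x p. x \<in> X \<and> p > 0}"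
    using Y by blast
  also have "\<dots> = {f ` g_quasi_ball X d x p | x p. x \<in> X \<and> p > 0}"
    using g_quasi_ball_transport[OF assms, of _ d] by metis
  also have "\<dots> = (`) f ` {g_quasi_ball X d x p | x p. x \<in> X \<and> p > 0}"
    by blast
  finally have C: "?C = (`) f ` ?B"
    by simp
  have "{\<Union>\<V> | \<V>. \<V> \<subseteq> (`) f ` ?B} = {\<Union>((`) f ` \<U>) | \<U>. \<U> \<subseteq> ?B}"
    unfolding subset_image_iff by blast
  also have "\<dots> = (`) f ` {\<Union>\<U> | \<U>. \<U> \<subseteq> ?B}"
    unfolding image_Union[symmetric] by blast
  finally show ?thesis
    unfolding induced_generalized_topology_def C .
qed

text \<open>Continuity of the inverse makes the image of every open set open; continuity of \<open>f\<close>
  makes every open set of \<open>Y\<close> the image of an open set, namely of its own preimage.\<close>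

lemma generalized_homeomorphism_image:
  assumes "\<mu> \<subseteq> Pow X" and "\<mu>' \<subseteq> Pow Y"
    and "generalized_homeomorphism X \<mu> Y \<mu>' f"
  shows "(`) f ` \<mu> = \<mu>'"
proof (intro equalityI subsetI)
  have f: "inj_on f X" "f ` X = Y"
    using assms(3) by (auto simp: generalized_homeomorphism_def bij_betw_def)
  fix G
  {
    assume "G \<in> (`) f ` \<mu>"
    then obtain U where U: "U \<in> \<mu>" "G = f ` U"
      by blast
    have "inv_into X f -` U \<inter> Y = f ` U"
      using f U(1) assms(1) by force
    moreover have "inv_into X f -` U \<inter> Y \<in> \<mu>'"
      using assms(3) U(1)
      by (simp add: generalized_homeomorphism_def generalized_continuous_def)
    ultimately show "G \<in> \<mu>'"
      using U(2) by simp
  next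
    assume G: "G \<in> \<mu>'"
    have "G = f ` (f -` G \<inter> X)"
      using f(2) G assms(2) by blast
    moreover have "f -` G \<inter> X \<in> \<mu>"
      using assms(3) G by (simp add: generalized_homeomorphism_def generalized_continuous_def)
    ultimately show "G \<in> (`) f ` \<mu>"
      by (rule image_eqI)
  }
qed

theorem theorem3p15:
  fixes X :: "'a set" and \<mu> :: "'a set set"
    and Y :: "'b set" and \<mu>' :: "'b set set"
    and f :: "'a \<Rightarrow> 'b"
  assumes "generalized_topology X \<mu>"
    and "generalized_topology Y \<mu>'"
    and "generalized_homeomorphism X \<mu> Y \<mu>' f"
    and "g_quasi_metrizable X \<mu>"
  shows "g_quasi_metrizable Y \<mu>'"
proof -
  obtain d r where d: "g_quasi_metric_index X d r" "induced_generalized_topology X d = \<mu>"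
    using assms(4) by (auto simp: g_quasi_metrizable_def g_quasi_metric_def)
  let ?e = "\<lambda>y z. d (inv_into X f y) (inv_into X f z)"
  have bij: "bij_betw f X Y"
    using assms(3) by (simp add: generalized_homeomorphism_def)
  have "g_quasi_metric Y ?e"
    using g_quasi_metric_index_transport[OF bij_betw_inv_into[OF bij] d(1)]
    by (auto simp: g_quasi_metric_def)
  moreover have "induced_generalized_topology Y ?e = (`) f ` \<mu>"
    using induced_generalized_topology_transport[OF bij] d(2) by simp
  moreover have "(`) f ` \<mu> = \<mu>'"
    using assms(1,2)
    by (intro generalized_homeomorphism_image[OF _ _ assms(3)])
      (simp_all add: generalized_topology_def)
  ultimately show ?thesis
    unfolding g_quasi_metrizable_def by metis
qed

end
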